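(* Let $L=(\vec L,[-,-],h_2)$ be a hemistrict Lie 2-algebra and $\vec V=(V^{-1}\xrightarrow dV^0)$ a 2-term cochain complex. Let $l:L^i\otimes V^j\to V^{i+j}$ and $r:V^j\otimes L^i\to V^{i+j}$ ($i,j\in\{-1,0\}$, $V^{-2}=0$) be cochain maps and $h_v:L^0\times V^0\to V^{-1}$ a bilinear map. Then $(l,r,h_v)$ defines a representation of $L$ on $\vec V$ if and only if the semidirect product $$L\oplus V=\big(\vec L\oplus\vec V,\ \{-,-\}=[-,-]+l+r,\ H=h_2+h_v\big)$$ is a hemistrict Lie 2-algebra.
   Context: All vector spaces are over $\mathbb K=\mathbb R$ or $\mathbb C$. 2-term cochain complexes sit in degrees $-1,0$; $|x|$ is the degree of $x$. **Hemistrict Lie 2-algebra** $L=(\vec L,[-,-],h_2)$: a 2-term complex $\vec L=(L^{-1}\xrightarrow dL^0)$, a degree-$0$ bilinear bracket on $L^\bullet$ (zero on $L^{-1}\times L^{-1}$) with $d[x,y]=[dx,y]+(-1)^{|x|}[x,dy]$ and $[x,[y,z]]=[[x,y],z]+(-1)^{|x||y|}[y,[x,z]]$, and a symmetric bilinear map $h_2:L^0\times L^0\to L^{-1}$ such that $[x,y]+[y,x]=dh_2(x,y)$, $[x,\alpha]+[\alpha,x]=h_2(x,d\alpha)$, $[h_2(x,y),z]=0$, $[x,h_2(y,z)]=h_2([x,y],z)+h_2(y,[x,z])$ for $x,y,z\in L^0,\alpha\in L^{-1}$. **Representation**: the triple $(l,r,h_v)$ (cochain maps $l,r$ and bilinear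 $h_v$) is a representation of $L$ on $\vec V$ if, writing $l_xv=l(x,v)$ and $r_xv=(-1)^{|x||v|}r(v,x)$: (i) $l_{[x_1,x_2]}v=l_{x_1}l_{x_2}v-(-1)^{|x_1||x_2|}l_{x_2}l_{x_1}v$ for all $x_1,x_2\in L^\bullet$, $v\in V^\bullet$; (ii) $l(x,v)+r(v,x)$ equals $dh_v(x,v)$ if $x\in L^0,v\in V^0$, equals $h_v(dx,v)$ if $x\in L^{-1},v\in V^0$, and equals $h_v(x,dv)$ if $x\in L^0,v\in V^{-1}$; (iii) for $x_1,x_2\in L^0,v\in V^0$: $r_{x_2}h_v(x_1,v)=0$, $l_{h_2(x_1,x_2)}v=0$, $l_{x_1}h_v(x_2,v)=h_v([x_1,x_2],v)+h_v(x_2,l_{x_1}v)$. In the semidirect product, $\{x+v,y+w\}=[x,y]+l(x,w)+r(v,y)$ for $x,y\in L^\bullet$, $v,w\in V^\bullet$, and $H(x+v,y+w)=h_2(x,y)+h_v(x,w)+h_v(y,v)$ for $x,y\in L^0$, $v,w\in V^0$. *)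

theory Defs
  imports "HOL-Analysis.Product_Vector"
begin

text \<open>
  A graded vector space is given by its total space, a vector space structure on a whole type,
  and the family of its homogeneous components, indexed by \<^typ>\<open>int\<close>.  A multilinear map of
  graded spaces is a map on the total spaces; its components are the restrictions to the
  homogeneous subspaces.

  The definitions make sense over any field.  The ground fields of interest, the real and the
  complex numbers, are by the Gelfand-Mazur theorem, up to isomorphism, exactly the instances of
  \<^class>\<open>real_normed_field\<close>.
\<close>

locale two_term_complex = vector_space scale
  for scale :: "'k::field \<Rightarrow> 'a::ab_group_add \<Rightarrow> 'a" +
  fixes C :: "int \<Rightarrow> 'a set" and d :: "'a \<Rightarrow> 'a"
  assumes subspace_comp: "subspace (C i)"
    and concentrated: "i \<noteq> -1 \<Longrightarrow> i \<noteq> 0 \<Longrightarrow> C i = {0}"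
    and comps_inter: "C (-1) \<inter> C 0 = {0}"
    and comps_span: "\<exists>a\<in>C (-1). \<exists>b\<in>C 0. v = a + b"
    and linear_d: "Vector_Spaces.linear scale scale d"
    and degree_d: "x \<in> C i \<Longrightarrow> d x \<in> C (i + 1)"

definition bilinear_on ::
  "('k \<Rightarrow> 'a::ab_group_add \<Rightarrow> 'a) \<Rightarrow> ('k \<Rightarrow> 'b::ab_group_add \<Rightarrow> 'b) \<Rightarrow> ('k \<Rightarrow> 'c::ab_group_add \<Rightarrow> 'c) \<Rightarrow>
   'a set \<Rightarrow> 'b set \<Rightarrow> 'c set \<Rightarrow> ('a \<Rightarrow> 'b \<Rightarrow> 'c) \<Rightarrow> bool"
where
  "bilinear_on sA sB sC A B C f \<longleftrightarrow>
     (\<forall>x\<in>A. \<forall>y\<in>B. f x y \<in> C) \<and>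
     (\<forall>x\<in>A. \<forall>x'\<in>A. \<forall>y\<in>B. f (x + x') y = f x y + f x' y) \<and>
     (\<forall>x\<in>A. \<forall>y\<in>B. \<forall>y'\<in>B. f x (y + y') = f x y + f x y') \<and>
     (\<forall>c. \<forall>x\<in>A. \<forall>y\<in>B. f (sA c x) y = sC c (f x y)) \<and>
     (\<forall>c. \<forall>x\<in>A. \<forall>y\<in>B. f x (sB c y) = sC c (f x y))"

definition koszul :: "int \<Rightarrow> 'a::ab_group_add \<Rightarrow> 'a" where
  "koszul n v = (if even n then v else - v)"

text \<open>
  A cochain map \<open>A \<otimes> B \<rightarrow> C\<close>, as a bilinear map of degree 0.  For complexes in degrees \<open>-1, 0\<close> the
  degree condition forces it to vanish on \<open>A (-1) \<times> B (-1)\<close>, because \<open>C (-2) = {0}\<close>; the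
  compatibility with the differentials is nevertheless a nontrivial condition there.
\<close>

definition cochain_map_tensor ::
  "('k \<Rightarrow> 'a::ab_group_add \<Rightarrow> 'a) \<Rightarrow> (int \<Rightarrow> 'a set) \<Rightarrow> ('a \<Rightarrow> 'a) \<Rightarrow>
   ('k \<Rightarrow> 'b::ab_group_add \<Rightarrow> 'b) \<Rightarrow> (int \<Rightarrow> 'b set) \<Rightarrow> ('b \<Rightarrow> 'b) \<Rightarrow>
   ('k \<Rightarrow> 'c::ab_group_add \<Rightarrow> 'c) \<Rightarrow> (int \<Rightarrow> 'c set) \<Rightarrow> ('c \<Rightarrow> 'c) \<Rightarrow>
   ('a \<Rightarrow> 'b \<Rightarrow> 'c) \<Rightarrow> bool"
where
  "cochain_map_tensor sA A dA sB B dB sC C dC f \<longleftrightarrow>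
     bilinear_on sA sB sC UNIV UNIV UNIV f \<and>
     (\<forall>i j. \<forall>x\<in>A i. \<forall>y\<in>B j. f x y \<in> C (i + j)) \<and>
     (\<forall>i j. \<forall>x\<in>A i. \<forall>y\<in>B j. dC (f x y) = f (dA x) y + koszul i (f x (dB y)))"

locale hemistrict_Lie_2_algebra = two_term_complex scale L d
  for scale :: "'k::field \<Rightarrow> 'l::ab_group_add \<Rightarrow> 'l"
    and L :: "int \<Rightarrow> 'l set" and d :: "'l \<Rightarrow> 'l" +
  fixes br :: "'l \<Rightarrow> 'l \<Rightarrow> 'l" and h :: "'l \<Rightarrow> 'l \<Rightarrow> 'l"
  assumes bracket: "cochain_map_tensor scale L d scale L d scale L d br"
    and Leibniz: "x \<in> L i \<Longrightarrow> y \<in> L j \<Longrightarrow> z \<in> L k \<Longrightarrow>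
      br x (br y z) = br (br x y) z + koszul (i * j) (br y (br x z))"
    and h_bilinear: "bilinear_on scale scale scale (L 0) (L 0) (L (-1)) h"
    and h_sym: "x \<in> L 0 \<Longrightarrow> y \<in> L 0 \<Longrightarrow> h x y = h y x"
    and bracket_skew: "x \<in> L 0 \<Longrightarrow> y \<in> L 0 \<Longrightarrow> br x y + br y x = d (h x y)"
    and bracket_skew': "x \<in> L 0 \<Longrightarrow> \<alpha> \<in> L (-1) \<Longrightarrow> br x \<alpha> + br \<alpha> x = h x (d \<alpha>)"
    and bracket_h_left: "x \<in> L 0 \<Longrightarrow> y \<in> L 0 \<Longrightarrow> z \<in> L 0 \<Longrightarrow> br (h x y) z = 0"
    and bracket_h_right: "x \<in> L 0 \<Longrightarrow> y \<in> L 0 \<Longrightarrow> z \<in> L 0 \<Longrightarrow>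
      br x (h y z) = h (br x y) z + h y (br x z)"

text \<open>
  The operators of the action are \<open>l\<^sub>x v = l x v\<close> and \<open>r\<^sub>x v = (-1)\<^bsup>|x||v|\<^esup> r v x\<close>.  The latter occurs
  below only for \<open>x\<close> of degree 0, where the sign is trivial.
\<close>

locale hemistrict_representation =
  L: hemistrict_Lie_2_algebra scL L dL br h + V: two_term_complex scV V dV
  for scL :: "'k::field \<Rightarrow> 'l::ab_group_add \<Rightarrow> 'l"
    and L :: "int \<Rightarrow> 'l set" and dL :: "'l \<Rightarrow> 'l"
    and br :: "'l \<Rightarrow> 'l \<Rightarrow> 'l" and h :: "'l \<Rightarrow> 'l \<Rightarrow> 'l"
    and scV :: "'k \<Rightarrow> 'v::ab_group_add \<Rightarrow> 'v"
    and V :: "int \<Rightarrow> 'v set" and dV :: "'v \<Rightarrow> 'v" +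
  fixes l :: "'l \<Rightarrow> 'v \<Rightarrow> 'v" and r :: "'v \<Rightarrow> 'l \<Rightarrow> 'v" and hv :: "'l \<Rightarrow> 'v \<Rightarrow> 'v"
  assumes l_cochain_map: "cochain_map_tensor scL L dL scV V dV scV V dV l"
    and r_cochain_map: "cochain_map_tensor scV V dV scL L dL scV V dV r"
    and hv_bilinear: "bilinear_on scL scV scV (L 0) (V 0) (V (-1)) hv"
    and l_bracket: "x \<in> L i \<Longrightarrow> y \<in> L j \<Longrightarrow> v \<in> V k \<Longrightarrow>
      l (br x y) v = l x (l y v) - koszul (i * j) (l y (l x v))"
    and l_plus_r_00: "x \<in> L 0 \<Longrightarrow> v \<in> V 0 \<Longrightarrow> l x v + r v x = dV (hv x v)"
    and l_plus_r_10: "x \<in> L (-1) \<Longrightarrow> v \<in> V 0 \<Longrightarrow> l x v + r v x = hv (dL x) v"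
    and l_plus_r_01: "x \<in> L 0 \<Longrightarrow> v \<in> V (-1) \<Longrightarrow> l x v + r v x = hv x (dV v)"
    and r_hv: "x \<in> L 0 \<Longrightarrow> y \<in> L 0 \<Longrightarrow> v \<in> V 0 \<Longrightarrow> r (hv x v) y = 0"
    and l_h: "x \<in> L 0 \<Longrightarrow> y \<in> L 0 \<Longrightarrow> v \<in> V 0 \<Longrightarrow> l (h x y) v = 0"
    and l_hv: "x \<in> L 0 \<Longrightarrow> y \<in> L 0 \<Longrightarrow> v \<in> V 0 \<Longrightarrow>
      l x (hv y v) = hv (br x y) v + hv y (l x v)"

text \<open>The element \<open>x + v\<close> of a direct sum is the pair \<open>(x, v)\<close>.\<close>

definition direct_sum_comps :: "(int \<Rightarrow> 'l set) \<Rightarrow> (int \<Rightarrow> 'v set) \<Rightarrow> int \<Rightarrow> ('l \<times> 'v) set" where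
  "direct_sum_comps L V i = L i \<times> V i"

definition semidirect_bracket ::
  "('l \<Rightarrow> 'l \<Rightarrow> 'l) \<Rightarrow> ('l \<Rightarrow> 'v \<Rightarrow> 'v) \<Rightarrow> ('v \<Rightarrow> 'l \<Rightarrow> 'v) \<Rightarrow>
   'l \<times> 'v \<Rightarrow> 'l \<times> 'v \<Rightarrow> 'l \<times> 'v::ab_group_add"
where
  "semidirect_bracket br l r = (\<lambda>(x, v) (y, w). (br x y, l x w + r v y))"

definition semidirect_h ::
  "('l \<Rightarrow> 'l \<Rightarrow> 'l) \<Rightarrow> ('l \<Rightarrow> 'v \<Rightarrow> 'v) \<Rightarrow> 'l \<times> 'v \<Rightarrow> 'l \<times> 'v \<Rightarrow> 'l \<times> 'v::ab_group_add"
where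
  "semidirect_h h hv = (\<lambda>(x, v) (y, w). (h x y, hv x w + hv y v))"

end

theory Submission
  imports Defs
begin

text \<open>
  The semidirect product bracket and \<open>H\<close> are built so that they are bilinear of the right degree,
  compatible with the differentials, and (for \<open>H\<close>) symmetric, whatever \<open>l\<close>, \<open>r\<close> and \<open>hv\<close> do; the
  content lies in the remaining five identities.  By multilinearity each of them can be
  tested on homogeneous arguments that lie in \<open>L\<close> or in \<open>V\<close>.  Arguments in \<open>L\<close> alone give the
  axioms of \<open>L\<close>, and two arguments from \<open>V\<close> give \<open>0 = 0\<close>, so what counts is exactly one
  argument \<open>v\<close> from \<open>V\<close>.

  Some positions of \<open>v\<close> give the axioms of a representation literally; this proves that the axioms
  are necessary (\<open>representation_if_semidirect\<close>).  For sufficiency the remaining positions have to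
  be derived.  They are the Leibniz identities with \<open>v\<close> in the middle (\<open>l_r_Leibniz\<close>) and on the
  left (\<open>r_bracket\<close>), and the compatibility of the bracket with \<open>H\<close> when \<open>v\<close> acts from the left
  (\<open>r_h\<close>).  All three follow because in degrees where the result can be nonzero, \<open>r v x\<close> equals
  \<open>- l x v\<close> up to a correction through \<open>hv\<close>.  The \<open>l\<close> parts cancel because \<open>l\<close>
  is an action, and the corrections cancel because \<open>hv\<close> is equivariant (\<open>l_hv\<close>).  The passage from
  the middle to the left position costs the term \<open>r (l y u + r u y) z\<close>, which vanishes since
  \<open>r\<close> kills the image of \<open>hv\<close> (\<open>r_anticommutator\<close>).
\<close>

section \<open>Maps between two-term complexes\<close>

lemma koszul_Pair: "koszul n (x, v) = (koszul n x, koszul n v)"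
  by (simp add: koszul_def)

lemma koszul_add: "koszul n (v + w) = koszul n v + koszul n w"
  by (simp add: koszul_def)

text \<open>
  The data to which both sides of the equivalence refer, before any compatibility between the
  actions and the bracket is imposed.
\<close>

locale action_data =
  L: hemistrict_Lie_2_algebra scL L dL br h + V: two_term_complex scV V dV
  for scL :: "'k::field \<Rightarrow> 'l::ab_group_add \<Rightarrow> 'l"
    and L :: "int \<Rightarrow> 'l set" and dL :: "'l \<Rightarrow> 'l"
    and br :: "'l \<Rightarrow> 'l \<Rightarrow> 'l" and h :: "'l \<Rightarrow> 'l \<Rightarrow> 'l"
    and scV :: "'k \<Rightarrow> 'v::ab_group_add \<Rightarrow> 'v"
    and V :: "int \<Rightarrow> 'v set" and dV :: "'v \<Rightarrow> 'v" +
  fixes l :: "'l \<Rightarrow> 'v \<Rightarrow> 'v" and r :: "'v \<Rightarrow> 'l \<Rightarrow> 'v" and hv :: "'l \<Rightarrow> 'v \<Rightarrow> 'v"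
  assumes l_cochain_map: "cochain_map_tensor scL L dL scV V dV scV V dV l"
    and r_cochain_map: "cochain_map_tensor scV V dV scL L dL scV V dV r"
    and hv_bilinear: "bilinear_on scL scV scV (L 0) (V 0) (V (-1)) hv"
begin

lemma dL_linear: "dL (x + y) = dL x + dL y" "dL (scL c x) = scL c (dL x)"
  using L.linear_d by (simp_all add: Vector_Spaces.linear_iff)

lemma dV_linear: "dV (v + w) = dV v + dV w" "dV (scV c v) = scV c (dV v)"
  using V.linear_d by (simp_all add: Vector_Spaces.linear_iff)

lemma br_linear:
  "br (x + x') y = br x y + br x' y" "br x (y + y') = br x y + br x y'"
  "br (scL c x) y = scL c (br x y)" "br x (scL c y) = scL c (br x y)"
  using L.bracket by (auto simp: cochain_map_tensor_def bilinear_on_def)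

lemma l_linear:
  "l (x + x') v = l x v + l x' v" "l x (v + v') = l x v + l x v'"
  "l (scL c x) v = scV c (l x v)" "l x (scV c v) = scV c (l x v)"
  using l_cochain_map by (auto simp: cochain_map_tensor_def bilinear_on_def)

lemma r_linear:
  "r (v + v') x = r v x + r v' x" "r v (x + x') = r v x + r v x'"
  "r (scV c v) x = scV c (r v x)" "r v (scL c x) = scV c (r v x)"
  using r_cochain_map by (auto simp: cochain_map_tensor_def bilinear_on_def)

lemma h_linear:
  assumes "x \<in> L 0" "x' \<in> L 0" "y \<in> L 0"
  shows "h (x + x') y = h x y + h x' y" "h y (x + x') = h y x + h y x'"
    "h (scL c x) y = scL c (h x y)" "h y (scL c x) = scL c (h y x)"
  using L.h_bilinear assms by (auto simp: bilinear_on_def)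

lemma hv_linear:
  assumes "x \<in> L 0" "x' \<in> L 0" "v \<in> V 0" "v' \<in> V 0"
  shows "hv (x + x') v = hv x v + hv x' v" "hv x (v + v') = hv x v + hv x v'"
    "hv (scL c x) v = scV c (hv x v)" "hv x (scV c v) = scV c (hv x v)"
  using hv_bilinear assms by (auto simp: bilinear_on_def)

lemma zero_mem [simp]: "0 \<in> L i" "0 \<in> V i"
  using L.subspace_comp V.subspace_comp by (simp_all add: L.subspace_0 V.subspace_0)

lemma add_mem: "x \<in> L i \<Longrightarrow> y \<in> L i \<Longrightarrow> x + y \<in> L i" "v \<in> V i \<Longrightarrow> w \<in> V i \<Longrightarrow> v + w \<in> V i"
  using L.subspace_comp V.subspace_comp by (auto intro: L.subspace_add V.subspace_add)

lemma zero_simps [simp]: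
  "dL 0 = 0" "dV 0 = 0" "br 0 x = 0" "br x 0 = 0" "l 0 v = 0" "l x 0 = 0" "r 0 x = 0" "r v 0 = 0"
  using dL_linear(1)[of 0 0] dV_linear(1)[of 0 0] br_linear(1)[of 0 0] br_linear(2)[of _ 0 0]
    l_linear(1)[of 0 0] l_linear(2)[of _ 0 0] r_linear(1)[of 0 0] r_linear(2)[of _ 0 0]
  by simp_all

lemma h_zero [simp]: "x \<in> L 0 \<Longrightarrow> h 0 x = 0" "x \<in> L 0 \<Longrightarrow> h x 0 = 0"
  using h_linear(1,2)[of 0 0 x] by auto

lemma hv_zero [simp]: "v \<in> V 0 \<Longrightarrow> hv 0 v = 0" "x \<in> L 0 \<Longrightarrow> hv x 0 = 0"
  using hv_linear(1)[of 0 0 v 0] hv_linear(2)[of x 0 0 0] by auto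

lemma l_diff: "l x (v - w) = l x v - l x w"
  using l_linear(2)[of x "v - w" w] by simp

lemma dV_diff: "dV (v - w) = dV v - dV w"
  using dV_linear(1)[of "v - w" w] by simp

lemma hv_diff: "x \<in> L 0 \<Longrightarrow> v \<in> V 0 \<Longrightarrow> w \<in> V 0 \<Longrightarrow> hv x (v - w) = hv x v - hv x w"
  using hv_linear(2)[of x x "v - w" w] V.subspace_diff[OF V.subspace_comp] by simp

lemma br_mem: "x \<in> L i \<Longrightarrow> y \<in> L j \<Longrightarrow> br x y \<in> L (i + j)"
  and l_mem: "x \<in> L i \<Longrightarrow> v \<in> V j \<Longrightarrow> l x v \<in> V (i + j)"
  and r_mem: "v \<in> V j \<Longrightarrow> x \<in> L i \<Longrightarrow> r v x \<in> V (j + i)"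
  using L.bracket l_cochain_map r_cochain_map by (auto simp: cochain_map_tensor_def)

lemma h_mem: "x \<in> L 0 \<Longrightarrow> y \<in> L 0 \<Longrightarrow> h x y \<in> L (-1)"
  and hv_mem: "x \<in> L 0 \<Longrightarrow> v \<in> V 0 \<Longrightarrow> hv x v \<in> V (-1)"
  using L.h_bilinear hv_bilinear by (auto simp: bilinear_on_def)

lemma d_br: "x \<in> L i \<Longrightarrow> y \<in> L j \<Longrightarrow> dL (br x y) = br (dL x) y + koszul i (br x (dL y))"
  using L.bracket unfolding cochain_map_tensor_def by blast

lemma d_l: "x \<in> L i \<Longrightarrow> v \<in> V j \<Longrightarrow> dV (l x v) = l (dL x) v + koszul i (l x (dV v))"
  using l_cochain_map unfolding cochain_map_tensor_def by blast

lemma d_r: "v \<in> V j \<Longrightarrow> x \<in> L i \<Longrightarrow> dV (r v x) = r (dV v) x + koszul j (r v (dL x))"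
  using r_cochain_map unfolding cochain_map_tensor_def by blast

lemma outside_degrees: "i \<noteq> -1 \<Longrightarrow> i \<noteq> 0 \<Longrightarrow> x \<in> L i \<Longrightarrow> x = 0"
    "i \<noteq> -1 \<Longrightarrow> i \<noteq> 0 \<Longrightarrow> v \<in> V i \<Longrightarrow> v = 0"
  using L.concentrated V.concentrated by auto

lemma dL_0: "x \<in> L 0 \<Longrightarrow> dL x = 0" and dV_0: "v \<in> V 0 \<Longrightarrow> dV v = 0"
  using L.degree_d[of x 0] V.degree_d[of v 0] outside_degrees[of 1] by auto

lemma dL_mem: "x \<in> L (-1) \<Longrightarrow> dL x \<in> L 0" and dV_mem: "v \<in> V (-1) \<Longrightarrow> dV v \<in> V 0"
  using L.degree_d[of x "-1"] V.degree_d[of v "-1"] by auto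

lemma prod_scale: "module_prod.scale scL scV c p = (scL c (fst p), scV c (snd p))"
proof -
  interpret P: vector_space_prod scL scV ..
  show ?thesis by (simp add: P.scale_def)
qed

section \<open>The unconditional part of the semidirect product\<close>

lemma direct_sum_complex:
  "two_term_complex (module_prod.scale scL scV) (direct_sum_comps L V) (map_prod dL dV)"
proof -
  interpret P: vector_space_prod scL scV ..
  have scale: "module_prod.scale scL scV c (x, v) = (scL c x, scV c v)" for c x v
    by (simp add: prod_scale)
  show ?thesis
  proof (intro two_term_complex.intro two_term_complex_axioms.intro)
    show "vector_space (module_prod.scale scL scV)"
      by (fact P.p.vector_space_axioms)
    fix i
    show "P.p.subspace (direct_sum_comps L V i)"
      using L.subspace_comp[of i] V.subspace_comp[of i]
      by (auto simp: P.p.subspace_def L.subspace_def V.subspace_def direct_sum_comps_def scale zero_prod_def)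
    show "i \<noteq> -1 \<Longrightarrow> i \<noteq> 0 \<Longrightarrow> direct_sum_comps L V i = {0}"
      by (auto simp: direct_sum_comps_def L.concentrated V.concentrated zero_prod_def)
    show "direct_sum_comps L V (-1) \<inter> direct_sum_comps L V 0 = {0}"
      using L.comps_inter V.comps_inter
      by (auto simp: direct_sum_comps_def Times_Int_Times zero_prod_def)
    show "Vector_Spaces.linear (module_prod.scale scL scV) (module_prod.scale scL scV) (map_prod dL dV)"
      by (simp add: Vector_Spaces.linear_iff P.p.vector_space_axioms split_paired_all scale dL_linear dV_linear)
    show "map_prod dL dV p \<in> direct_sum_comps L V (i + 1)" if "p \<in> direct_sum_comps L V i" for p
      using that L.degree_d V.degree_d by (auto simp: direct_sum_comps_def)
    show "\<exists>a\<in>direct_sum_comps L V (-1). \<exists>b\<in>direct_sum_comps L V 0. p = a + b" for p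
    proof -
      obtain x v where p: "p = (x, v)" by fastforce
      obtain a b where ab: "a \<in> L (-1)" "b \<in> L 0" "x = a + b" using L.comps_span by blast
      obtain a' b' where ab': "a' \<in> V (-1)" "b' \<in> V 0" "v = a' + b'" using V.comps_span by blast
      have "(a, a') \<in> direct_sum_comps L V (-1)" "(b, b') \<in> direct_sum_comps L V 0" "p = (a, a') + (b, b')"
        using ab ab' p by (auto simp: direct_sum_comps_def)
      then show ?thesis by blast
    qed
  qed
qed

lemma semidirect_cochain_map:
  "cochain_map_tensor (module_prod.scale scL scV) (direct_sum_comps L V) (map_prod dL dV)
     (module_prod.scale scL scV) (direct_sum_comps L V) (map_prod dL dV)
     (module_prod.scale scL scV) (direct_sum_comps L V) (map_prod dL dV) (semidirect_bracket br l r)"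
  unfolding cochain_map_tensor_def bilinear_on_def
proof (intro conjI allI ballI)
  fix i j p q
  assume p: "p \<in> direct_sum_comps L V i" and q: "q \<in> direct_sum_comps L V j"
  obtain x v y w where [simp]: "p = (x, v)" "q = (y, w)" by fastforce
  have m: "x \<in> L i" "v \<in> V i" "y \<in> L j" "w \<in> V j" using p q by (auto simp: direct_sum_comps_def)
  show "semidirect_bracket br l r p q \<in> direct_sum_comps L V (i + j)"
    using m by (auto simp: semidirect_bracket_def direct_sum_comps_def br_mem l_mem r_mem intro: add_mem)
  show "map_prod dL dV (semidirect_bracket br l r p q) =
      semidirect_bracket br l r (map_prod dL dV p) q +
      koszul i (semidirect_bracket br l r p (map_prod dL dV q))"
    using m by (simp add: semidirect_bracket_def koszul_Pair koszul_add dV_linear d_br d_l d_r)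
qed (auto simp: semidirect_bracket_def prod_scale br_linear l_linear r_linear V.scale_right_distrib)

lemma semidirect_h_bilinear:
  "bilinear_on (module_prod.scale scL scV) (module_prod.scale scL scV) (module_prod.scale scL scV)
     (direct_sum_comps L V 0) (direct_sum_comps L V 0) (direct_sum_comps L V (-1)) (semidirect_h h hv)"
  unfolding bilinear_on_def
  by (auto simp: semidirect_h_def direct_sum_comps_def prod_scale h_linear hv_linear h_mem hv_mem
      V.scale_right_distrib intro: add_mem)

section \<open>Necessity of the representation axioms\<close>

text \<open>
  Each axiom relating \<open>l\<close>, \<open>r\<close> and \<open>hv\<close> is the component in \<open>V\<close> of an axiom of the semidirect product,
  evaluated at arguments of which exactly one lies in \<open>V\<close> and the others in \<open>L\<close>.
\<close>

lemma representation_if_semidirect: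
  assumes "hemistrict_Lie_2_algebra (module_prod.scale scL scV) (direct_sum_comps L V) (map_prod dL dV)
      (semidirect_bracket br l r) (semidirect_h h hv)"
  shows "hemistrict_representation scL L dL br h scV V dV l r hv"
proof -
  interpret S: hemistrict_Lie_2_algebra "module_prod.scale scL scV" "direct_sum_comps L V"
    "map_prod dL dV" "semidirect_bracket br l r" "semidirect_h h hv"
    by (fact assms)
  note simps = semidirect_bracket_def semidirect_h_def direct_sum_comps_def koszul_Pair
  show ?thesis
  proof
    show "l (br x y) v = l x (l y v) - koszul (i * j) (l y (l x v))"
      if "x \<in> L i" "y \<in> L j" "v \<in> V k" for x y v i j k
      using S.Leibniz[of "(x, 0)" i "(y, 0)" j "(0, v)" k] that by (simp add: simps)
    show "l x v + r v x = dV (hv x v)" if "x \<in> L 0" "v \<in> V 0" for x v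
      using S.bracket_skew[of "(x, 0)" "(0, v)"] that by (simp add: simps)
    show "l x v + r v x = hv (dL x) v" if "x \<in> L (-1)" "v \<in> V 0" for x v
      using S.bracket_skew'[of "(0, v)" "(x, 0)"] that by (simp add: simps dL_mem add.commute)
    show "l x v + r v x = hv x (dV v)" if "x \<in> L 0" "v \<in> V (-1)" for x v
      using S.bracket_skew'[of "(x, 0)" "(0, v)"] that by (simp add: simps dV_mem)
    show "r (hv x v) y = 0" if "x \<in> L 0" "y \<in> L 0" "v \<in> V 0" for x y v
      using S.bracket_h_left[of "(x, 0)" "(0, v)" "(y, 0)"] that by (simp add: simps zero_prod_def)
    show "l (h x y) v = 0" if "x \<in> L 0" "y \<in> L 0" "v \<in> V 0" for x y v
      using S.bracket_h_left[of "(x, 0)" "(y, 0)" "(0, v)"] that by (simp add: simps zero_prod_def)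
    show "l x (hv y v) = hv (br x y) v + hv y (l x v)" if "x \<in> L 0" "y \<in> L 0" "v \<in> V 0" for x y v
      using S.bracket_h_right[of "(x, 0)" "(y, 0)" "(0, v)"] that br_mem[of x 0 y 0] l_mem[of x 0 v 0]
      by (simp add: simps)
  qed (fact l_cochain_map r_cochain_map hv_bilinear)+
qed

end

section \<open>Consequences of the representation axioms\<close>

sublocale hemistrict_representation \<subseteq> action_data
  by unfold_locales (fact l_cochain_map r_cochain_map hv_bilinear)+

context hemistrict_representation
begin

text \<open>The right action is determined by \<open>l\<close> and \<open>hv\<close>, except on two arguments of degree \<open>-1\<close>,
  where it vanishes.\<close>

lemma r_00: "v \<in> V 0 \<Longrightarrow> x \<in> L 0 \<Longrightarrow> r v x = dV (hv x v) - l x v"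
  and r_01: "v \<in> V 0 \<Longrightarrow> x \<in> L (-1) \<Longrightarrow> r v x = hv (dL x) v - l x v"
  and r_10: "v \<in> V (-1) \<Longrightarrow> x \<in> L 0 \<Longrightarrow> r v x = hv x (dV v) - l x v"
  using l_plus_r_00 l_plus_r_10 l_plus_r_01 by (simp_all add: eq_diff_eq add.commute)

text \<open>
  A trilinear identity of degree 0 with values in \<open>V\<close> is trivial when an argument vanishes, and
  when the total degree is below \<open>-1\<close>, since both sides then lie in a zero component.  Hence at
  most one argument has degree \<open>-1\<close> in the cases that need work.
\<close>

lemma degree_cases:
  assumes "x \<in> L i" "v \<in> V j" "z \<in> L k"
  obtains (zero) "x = 0 \<or> v = 0 \<or> z = 0"
  | (low) "i + j + k < -1"
  | (d000) "i = 0" "j = 0" "k = 0"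
  | (d100) "i = -1" "j = 0" "k = 0"
  | (d010) "i = 0" "j = -1" "k = 0"
  | (d001) "i = 0" "j = 0" "k = -1"
proof -
  have "x = 0 \<or> v = 0 \<or> z = 0 \<or> i \<in> {-1, 0} \<and> j \<in> {-1, 0} \<and> k \<in> {-1, 0}"
    using assms outside_degrees by blast
  then show thesis using that by auto
qed

text \<open>
  Replacing \<open>r v z\<close> by \<open>- l z v\<close> throughout turns this identity into \<open>l_bracket\<close>.  The correction terms that
  remain are the equivariance \<open>l_hv\<close> of \<open>hv\<close>, to which the differential is applied in
  total degree 0; in total degree \<open>-1\<close> it is \<open>l_hv\<close> with the argument of degree \<open>-1\<close> replaced by
  its differential.
\<close>

lemma l_r_Leibniz:
  assumes x: "x \<in> L i" and v: "v \<in> V j" and z: "z \<in> L k"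
  shows "l x (r v z) = r (l x v) z + koszul (i * j) (r v (br x z))"
  using x v z
proof (cases rule: degree_cases)
  case zero
  then show ?thesis by (auto simp: koszul_def)
next
  case low
  have "l x (r v z) \<in> V (i + j + k)" "r (l x v) z \<in> V (i + j + k)" "r v (br x z) \<in> V (i + j + k)"
    using l_mem[OF x r_mem[OF v z]] r_mem[OF l_mem[OF x v] z] r_mem[OF v br_mem[OF x z]]
    by (simp_all add: add_ac)
  then have "l x (r v z) = 0" "r (l x v) z = 0" "r v (br x z) = 0"
    using outside_degrees(2)[of "i + j + k"] low by auto
  then show ?thesis by (simp add: koszul_def)
next
  case d000
  have m: "x \<in> L 0" "v \<in> V 0" "z \<in> L 0" using x v z d000 by auto
  have "l x v \<in> V 0" "br x z \<in> L 0" using l_mem[of x 0 v 0] br_mem[of x 0 z 0] m by auto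
  moreover have "dV (l x (hv z v)) = l x (dV (hv z v))"
    using d_l[of x 0 "hv z v" "-1"] m hv_mem by (simp add: koszul_def dL_0)
  ultimately show ?thesis
    using d000 m l_bracket[of x 0 z 0 v 0] l_hv[of x z v]
    by (simp add: r_00 koszul_def l_diff dV_diff dV_linear add.commute)
next
  case d100
  have m: "x \<in> L (-1)" "v \<in> V 0" "z \<in> L 0" using x v z d100 by auto
  have m': "dL x \<in> L 0" "l x v \<in> V (-1)" "br x z \<in> L (-1)"
    using m dL_mem l_mem[of x "-1" v 0] br_mem[of x "-1" z 0] by auto
  \<comment> \<open>The product \<open>l x (hv z v)\<close> has degree \<open>-2\<close>; differentiating it lets the differential
    move from the second factor to the first.\<close>
  have "l x (hv z v) = 0"
    using l_mem[of x "-1" "hv z v" "-1"] m hv_mem outside_degrees(2)[of "-2"] by simp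
  then have "l x (dV (hv z v)) = l (dL x) (hv z v)"
    using d_l[of x "-1" "hv z v" "-1"] m hv_mem by (simp add: koszul_def)
  moreover have "dV (l x v) = l (dL x) v" "dL (br x z) = br (dL x) z"
    using m d_l[of x "-1" v 0] d_br[of x "-1" z 0] by (simp_all add: dL_0 dV_0 koszul_def)
  ultimately show ?thesis
    using d100 m m' l_bracket[of x "-1" z 0 v 0] l_hv[of "dL x" z v]
    by (simp add: r_00 r_01 r_10 koszul_def l_diff)
next
  case d010
  have m: "x \<in> L 0" "v \<in> V (-1)" "z \<in> L 0" using x v z d010 by auto
  have m': "dV v \<in> V 0" "l x v \<in> V (-1)" "br x z \<in> L 0"
    using m dV_mem l_mem[of x 0 v "-1"] br_mem[of x 0 z 0] by auto
  have "dV (l x v) = l x (dV v)"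
    using m d_l[of x 0 v "-1"] by (simp add: dL_0 koszul_def)
  then show ?thesis
    using d010 m m' l_bracket[of x 0 z 0 v "-1"] l_hv[of x z "dV v"]
    by (simp add: r_10 koszul_def l_diff)
next
  case d001
  have m: "x \<in> L 0" "v \<in> V 0" "z \<in> L (-1)" using x v z d001 by auto
  have m': "dL z \<in> L 0" "l x v \<in> V 0" "br x z \<in> L (-1)"
    using m dL_mem l_mem[of x 0 v 0] br_mem[of x 0 z "-1"] by auto
  have "dL (br x z) = br x (dL z)"
    using m d_br[of x 0 z "-1"] by (simp add: dL_0 koszul_def)
  then show ?thesis
    using d001 m m' l_bracket[of x 0 z "-1" v 0] l_hv[of x "dL z" v]
    by (simp add: r_01 koszul_def l_diff)
qed

text \<open>
  If exactly one of \<open>y\<close>, \<open>u\<close> has degree \<open>-1\<close> and all else has degree 0, the sum \<open>l y u + r u y\<close>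
  is a value of \<open>hv\<close>, which \<open>r\<close> annihilates.  If \<open>y\<close> and \<open>u\<close> both have degree 0, it is only the
  differential of such a value, and then the Leibniz rule for the differential applies.
\<close>

lemma r_anticommutator:
  assumes y: "y \<in> L i" and u: "u \<in> V j" and z: "z \<in> L k"
  shows "r (l y u + r u y) z = 0"
  using y u z
proof (cases rule: degree_cases)
  case zero
  then show ?thesis by auto
next
  case low
  have "l y u + r u y \<in> V (i + j)"
    using l_mem[OF y u] r_mem[OF u y] by (simp add: add_mem add.commute)
  then have "r (l y u + r u y) z \<in> V (i + j + k)" using r_mem z by blast
  then show ?thesis using outside_degrees(2)[of "i + j + k"] low by auto
next
  case d000
  then have m: "y \<in> L 0" "u \<in> V 0" "z \<in> L 0" using y u z by auto
  then show ?thesis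
    using d_r[of "hv y u" "-1" z 0] by (simp add: l_plus_r_00 r_hv hv_mem dL_0 koszul_def)
next
  case d100
  then show ?thesis using y u z by (simp add: l_plus_r_10 r_hv dL_mem)
next
  case d010
  then show ?thesis using y u z by (simp add: l_plus_r_01 r_hv dV_mem)
next
  case d001
  then have m: "y \<in> L 0" "u \<in> V 0" "z \<in> L (-1)" using y u z by auto
  then have "r (hv y u) z = 0"
    using r_mem[of "hv y u" "-1" z "-1"] hv_mem outside_degrees(2)[of "-2"] by simp
  then show ?thesis
    using m d_r[of "hv y u" "-1" z "-1"] by (simp add: l_plus_r_00 r_hv hv_mem dL_mem koszul_def)
qed

text \<open>
  Exchanging the roles of the first two arguments in \<open>l_r_Leibniz\<close> gives this identity up to
  \<open>r_anticommutator\<close>.  The Koszul signs match because they can be negative only where all terms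
  have degree below \<open>-1\<close>.
\<close>

lemma r_bracket:
  assumes u: "u \<in> V i" and y: "y \<in> L j" and z: "z \<in> L k"
  shows "r u (br y z) = r (r u y) z + koszul (i * j) (l y (r u z))"
proof -
  have "r (r u y) z = - r (l y u) z"
    using r_anticommutator[OF y u z] by (simp add: r_linear eq_neg_iff_add_eq_0 add.commute)
  moreover have "l y (r u z) = r (l y u) z + koszul (i * j) (r u (br y z))"
    using l_r_Leibniz[OF y u z] by (simp add: mult.commute)
  moreover have "r (l y u) z = 0" if "odd (i * j)"
  proof (cases "i = -1 \<and> j = -1")
    case True
    then have "l y u = 0" using l_mem[OF y u] outside_degrees(2)[of "j + i"] by auto
    then show ?thesis by simp
  next
    case False
    then have "i \<notin> {-1, 0} \<or> j \<notin> {-1, 0}" using that by auto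
    then have "u = 0 \<or> y = 0" using outside_degrees u y by blast
    then show ?thesis by auto
  qed
  ultimately show ?thesis by (auto simp: koszul_def)
qed

text \<open>
  Both sides equal \<open>hv (br y z + br z y) u\<close>.  On the left, the \<open>l\<close> part of \<open>r u (h y z)\<close> vanishes
  by \<open>l_h\<close>.  On the right, \<open>hv z (dV (hv y u)) = l z (hv y u)\<close> because \<open>r\<close> annihilates
  \<open>hv y u\<close>; after expanding with \<open>l_hv\<close>, the terms \<open>l z (hv y u)\<close> and \<open>l y (hv z u)\<close> cancel between
  the two summands.
\<close>

lemma r_h:
  assumes m: "u \<in> V 0" "y \<in> L 0" "z \<in> L 0"
  shows "r u (h y z) = hv z (r u y) + hv y (r u z)"
proof -
  have m': "l y u \<in> V 0" "l z u \<in> V 0" "hv y u \<in> V (-1)" "hv z u \<in> V (-1)" "br y z \<in> L 0" "br z y \<in> L 0"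
    using m l_mem[of y 0 u 0] l_mem[of z 0 u 0] br_mem[of y 0 z 0] br_mem[of z 0 y 0] hv_mem by auto
  have d: "dV (hv y u) \<in> V 0" "dV (hv z u) \<in> V 0"
    using m' dV_mem by auto
  have "hv z (r u y) = l z (hv y u) - l y (hv z u) + hv (br y z) u"
    using m m' d l_plus_r_01[of z "hv y u"] r_hv[of y z u] l_hv[of y z u]
    by (simp add: r_00 hv_diff)
  moreover have "hv y (r u z) = l y (hv z u) - l z (hv y u) + hv (br z y) u"
    using m m' d l_plus_r_01[of y "hv z u"] r_hv[of z y u] l_hv[of z y u]
    by (simp add: r_00 hv_diff)
  moreover have "r u (h y z) = hv (br y z) u + hv (br z y) u"
    using m m' r_01[of u "h y z"] h_mem[of y z] l_h[of y z u] L.bracket_skew[of y z]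
      hv_linear(1)[of "br y z" "br z y" u u] by simp
  ultimately show ?thesis by simp
qed

section \<open>Sufficiency of the representation axioms\<close>

lemma semidirect_hemistrict_Lie_2_algebra:
  "hemistrict_Lie_2_algebra (module_prod.scale scL scV) (direct_sum_comps L V) (map_prod dL dV)
      (semidirect_bracket br l r) (semidirect_h h hv)"
proof -
  interpret S: two_term_complex "module_prod.scale scL scV" "direct_sum_comps L V" "map_prod dL dV"
    by (fact direct_sum_complex)
  note simps = semidirect_bracket_def semidirect_h_def direct_sum_comps_def
  show ?thesis
  proof (unfold_locales, goal_cases)
    case 1
    show ?case by (fact semidirect_cochain_map)
  next
    case (2 p i q j s k)
    obtain x u y v z w where e: "p = (x, u)" "q = (y, v)" "s = (z, w)" by fastforce
    have m: "x \<in> L i" "u \<in> V i" "y \<in> L j" "v \<in> V j" "z \<in> L k" "w \<in> V k"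
      using 2 e by (auto simp: simps)
    show ?case
      using m L.Leibniz[of x i y j z k] l_bracket[of x i y j w k] l_r_Leibniz[of x i v j z k]
        r_bracket[of u i y j z k]
      by (simp add: e simps koszul_Pair l_linear r_linear koszul_add)
  next
    case 3
    show ?case by (fact semidirect_h_bilinear)
  next
    case (4 p q)
    then show ?case by (auto simp: simps L.h_sym add.commute)
  next
    case (5 p q)
    then show ?case
      by (auto simp: simps L.bracket_skew dV_linear simp flip: l_plus_r_00)
  next
    case (6 p q)
    then show ?case
      by (auto simp: simps L.bracket_skew' simp flip: l_plus_r_01 l_plus_r_10)
  next
    case (7 p q s)
    then show ?case
      by (auto simp: simps L.bracket_h_left l_h r_hv r_linear zero_prod_def)
  next
    case (8 p q s)
    obtain x u y v z w where e: "p = (x, u)" "q = (y, v)" "s = (z, w)" by fastforce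
    have m: "x \<in> L 0" "u \<in> V 0" "y \<in> L 0" "v \<in> V 0" "z \<in> L 0" "w \<in> V 0"
      using 8 e by (auto simp: simps)
    have m': "l x v \<in> V 0" "r u y \<in> V 0" "l x w \<in> V 0" "r u z \<in> V 0"
      using m l_mem[of x 0 _ 0] r_mem[of u 0 _ 0] by auto
    show ?case
      using m m' L.bracket_h_right[of x y z] r_h[of u y z] l_hv[of x y w] l_hv[of x z v]
        hv_linear(2)[of z z "l x v" "r u y"] hv_linear(2)[of y y "l x w" "r u z"]
      by (simp add: e simps l_linear)
  qed
qed

end

section \<open>The equivalence\<close>

theorem proposition2p31:
  fixes scL :: "'k::real_normed_field \<Rightarrow> 'l::ab_group_add \<Rightarrow> 'l"
    and L :: "int \<Rightarrow> 'l set" and dL :: "'l \<Rightarrow> 'l"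
    and br :: "'l \<Rightarrow> 'l \<Rightarrow> 'l" and h2 :: "'l \<Rightarrow> 'l \<Rightarrow> 'l"
    and scV :: "'k \<Rightarrow> 'v::ab_group_add \<Rightarrow> 'v"
    and V :: "int \<Rightarrow> 'v set" and dV :: "'v \<Rightarrow> 'v"
    and l :: "'l \<Rightarrow> 'v \<Rightarrow> 'v" and r :: "'v \<Rightarrow> 'l \<Rightarrow> 'v" and hv :: "'l \<Rightarrow> 'v \<Rightarrow> 'v"
  assumes "hemistrict_Lie_2_algebra scL L dL br h2"
    and "two_term_complex scV V dV"
    and "cochain_map_tensor scL L dL scV V dV scV V dV l"
    and "cochain_map_tensor scV V dV scL L dL scV V dV r"
    and "bilinear_on scL scV scV (L 0) (V 0) (V (-1)) hv"
  shows "hemistrict_representation scL L dL br h2 scV V dV l r hv \<longleftrightarrow>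
    hemistrict_Lie_2_algebra (module_prod.scale scL scV) (direct_sum_comps L V) (map_prod dL dV)
      (semidirect_bracket br l r) (semidirect_h h2 hv)"
proof -
  interpret action_data scL L dL br h2 scV V dV l r hv
    using assms by (simp add: action_data_def action_data_axioms_def)
  show ?thesis
    using representation_if_semidirect
      hemistrict_representation.semidirect_hemistrict_Lie_2_algebra by blast
qed

end
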